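(* A symmetric function $f:\{-1,1\}^n\to\{-1,1\}$ is computable by a quasi-polynomial size Threshold of Parity circuit if and only if its odd-even degree is $\log^{O(1)} n$. That is, for a family of symmetric functions $f_n:\{-1,1\}^n\to\{-1,1\}$, one has $\mathrm{mon}_\pm(f_n)\le 2^{\log^{O(1)}n}$ if and only if $\deg_{oe}(f_n)\le \log^{O(1)}n$.
   Context: For symmetric $f$ with predicate $D_f:\{0,\dots,n\}\to\{-1,1\}$ ($D_f(i)$ is the value of $f$ on inputs with exactly $i$ coordinates equal to $-1$), the odd-even degree is $\deg_{oe}(f)=|\{i\in\{0,\dots,n-2\}:D_f(i)\ne D_f(i+2)\}|$. A Threshold of Parity circuit is a single linear threshold gate applied to parities of subsets of the input variables; the minimum size of such a circuit computing $f$ equals the signed monomial complexity $\mathrm{mon}_\pm(f)$, the minimum number of monomials in a real polynomial $p$ with $\mathrm{sgn}(p(x))=f(x)$ for all $x\in\{-1,1\}^n$. *)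

theory Defs
  imports Complex_Main "HOL-Library.FuncSet" "HOL-Library.Poly_Mapping"
    "HOL-Combinatorics.Permutations"
begin

definition cube :: "nat \<Rightarrow> (nat \<Rightarrow> real) set" where
  "cube n = {..<n} \<rightarrow>\<^sub>E {-1, 1}"

definition boolean_function :: "nat \<Rightarrow> ((nat \<Rightarrow> real) \<Rightarrow> real) \<Rightarrow> bool" where
  "boolean_function n f \<longleftrightarrow> f \<in> cube n \<rightarrow> {-1, 1}"

text \<open>A permutation of \<open>{..<n}\<close> fixes every other index, so \<open>x \<circ> \<pi>\<close> stays extensional,
  i.e. in \<open>cube n\<close>.\<close>

definition symmetric_function :: "nat \<Rightarrow> ((nat \<Rightarrow> real) \<Rightarrow> real) \<Rightarrow> bool" where
  "symmetric_function n f \<longleftrightarrow>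
     (\<forall>\<pi>. \<pi> permutes {..<n} \<longrightarrow> (\<forall>x \<in> cube n. f (x \<circ> \<pi>) = f x))"

definition predicate_of :: "nat \<Rightarrow> ((nat \<Rightarrow> real) \<Rightarrow> real) \<Rightarrow> nat \<Rightarrow> real" where
  "predicate_of n f i =
     (THE b. \<forall>x \<in> cube n. card {j \<in> {..<n}. x j = -1} = i \<longrightarrow> f x = b)"

text \<open>The range \<open>{0, \<dots>, n - 2}\<close> is written as \<open>i + 2 \<le> n\<close>, so that it is empty for \<open>n < 2\<close>
  in spite of truncated subtraction.\<close>

definition deg_oe :: "nat \<Rightarrow> ((nat \<Rightarrow> real) \<Rightarrow> real) \<Rightarrow> nat" where
  "deg_oe n f = card {i. i + 2 \<le> n \<and> predicate_of n f i \<noteq> predicate_of n f (i + 2)}"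

text \<open>A real polynomial is a finitely supported map from exponent vectors to coefficients;
  the keys of the polynomial are the monomials occurring in it.\<close>

type_synonym real_mpoly = "(nat \<Rightarrow>\<^sub>0 nat) \<Rightarrow>\<^sub>0 real"

definition mpoly_in_vars :: "nat \<Rightarrow> real_mpoly \<Rightarrow> bool" where
  "mpoly_in_vars n p \<longleftrightarrow> (\<forall>m \<in> Poly_Mapping.keys p. Poly_Mapping.keys m \<subseteq> {..<n})"

definition mpoly_eval :: "real_mpoly \<Rightarrow> (nat \<Rightarrow> real) \<Rightarrow> real" where
  "mpoly_eval p x =
     (\<Sum>m \<in> Poly_Mapping.keys p. Poly_Mapping.lookup p m *
        (\<Prod>i \<in> Poly_Mapping.keys m. x i ^ Poly_Mapping.lookup m i))"

definition num_monomials :: "real_mpoly \<Rightarrow> nat" where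
  "num_monomials p = card (Poly_Mapping.keys p)"

definition sign_represents :: "nat \<Rightarrow> real_mpoly \<Rightarrow> ((nat \<Rightarrow> real) \<Rightarrow> real) \<Rightarrow> bool" where
  "sign_represents n p f \<longleftrightarrow>
     mpoly_in_vars n p \<and> (\<forall>x \<in> cube n. sgn (mpoly_eval p x) = f x)"

definition mon_pm :: "nat \<Rightarrow> ((nat \<Rightarrow> real) \<Rightarrow> real) \<Rightarrow> nat" where
  "mon_pm n f = (LEAST k. \<exists>p. sign_represents n p f \<and> num_monomials p = k)"

text \<open>A Threshold of Parity circuit is given by the parity gates feeding the threshold gate, each
  with its weight; over \<open>{-1, 1}\<close> the parity of a set of variables is their product. The threshold
  itself is not a separate parameter: it is the weight of the parity of the empty set, which counts
  towards the size just as the constant monomial counts towards \<open>mon_pm\<close>.\<close>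

type_synonym thr_parity_circuit = "(real \<times> nat set) list"

definition parity :: "nat set \<Rightarrow> (nat \<Rightarrow> real) \<Rightarrow> real" where
  "parity S x = (\<Prod>i \<in> S. x i)"

definition circuit_output :: "thr_parity_circuit \<Rightarrow> (nat \<Rightarrow> real) \<Rightarrow> real" where
  "circuit_output C x = sgn (\<Sum>(w, S) \<leftarrow> C. w * parity S x)"

definition circuit_size :: "thr_parity_circuit \<Rightarrow> nat" where
  "circuit_size C = length C"

definition circuit_computes ::
  "nat \<Rightarrow> thr_parity_circuit \<Rightarrow> ((nat \<Rightarrow> real) \<Rightarrow> real) \<Rightarrow> bool" where
  "circuit_computes n C f \<longleftrightarrow>
     (\<forall>(w, S) \<in> set C. S \<subseteq> {..<n}) \<and> (\<forall>x \<in> cube n. circuit_output C x = f x)"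

definition polylog_bounded :: "(nat \<Rightarrow> nat) \<Rightarrow> bool" where
  "polylog_bounded g \<longleftrightarrow>
     (\<exists>c::real. \<forall>\<^sub>F n in sequentially. real (g n) \<le> log 2 (real n) powr c)"

definition quasipoly_bounded :: "(nat \<Rightarrow> nat) \<Rightarrow> bool" where
  "quasipoly_bounded g \<longleftrightarrow>
     (\<exists>c::real. \<forall>\<^sub>F n in sequentially. real (g n) \<le> 2 powr (log 2 (real n) powr c))"

end

(* Upper bound: on the inputs of even weight f is the sign of a polynomial in the weight whose degree
   is the number of sign changes of D_f along the even numbers, and likewise for odd weight.
   Multiplying the two polynomials by (1 + chi)/2 and (1 - chi)/2, with chi the full parity, and adding
   gives a combination of parities of at most deg_oe(f) variables and of complements of such sets.

   Lower bound: let r + 4k <= n, fix r variables to -1, set n - r - 4k variables to 1, and group the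
   remaining 4k variables into k couples of pairs.  From each couple choose a pair (u, u) with weight 0
   or 2; the other pair is (u, -u) with weight 1.  The restricted function then depends on the k chosen
   bits u only through their number m of -1's, via D_f(r + k + 2m); let d be its number of sign
   changes.  Multiplying the full parity of the chosen bits by a polynomial in m of degree k - d yields
   a test function with the sign of the restricted f that is orthogonal to every parity except those of
   at least d chosen bits and no others.  A fixed parity survives at most a 2^-d fraction of the 2^k
   choices, so fewer than 2^d parities can all be killed at once: a circuit has size at least 2^d.
   O(log n) such windows [r + k, r + 3k] cover all the weights, hence deg_oe(f) = O(log n * log size). *)

theory Submission imports Defs begin

section \<open>Parities and low-degree functions on the cube\<close>

lemma cube_signs: "x \<in> cube n \<Longrightarrow> \<forall>i\<in>{..<n}. x i \<in> {-1, 1}"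
  by (auto simp: cube_def PiE_def Pi_def)

lemma finite_cube: "finite (cube n)"
  by (auto simp: cube_def intro: finite_PiE)

lemma card_minus_ones:
  assumes "finite A" "\<forall>i\<in>A. u i \<in> {-1, 1::real}"
  shows "real (card {i \<in> A. u i = -1}) = (\<Sum>i\<in>A. (1 - u i) / 2)"
proof -
  have "real (card {i \<in> A. u i = -1}) = (\<Sum>i\<in>A. of_bool (u i = -1))"
    using assms(1) by (simp add: Int_def)
  also have "\<dots> = (\<Sum>i\<in>A. (1 - u i) / 2)"
    using assms(2) by (intro sum.cong) auto
  finally show ?thesis .
qed

lemma parity_eq_power:
  assumes "finite A" "\<forall>i\<in>A. u i \<in> {-1, 1::real}"
  shows "parity A u = (-1) ^ card {i \<in> A. u i = -1}"
proof -
  have "parity A u = (\<Prod>i\<in>A. if u i = -1 then -1 else 1)"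
    unfolding parity_def using assms(2) by (intro prod.cong) auto
  then show ?thesis
    using assms(1) by (simp add: prod.If_cases Int_def)
qed

text \<open>A coordinate in both sets contributes a square, which is 1 for signs, so only the
  symmetric difference survives.\<close>

lemma parity_mult:
  assumes "finite A" "finite B" "\<forall>i\<in>A \<union> B. u i \<in> {-1, 1::real}"
  shows "parity A u * parity B u = parity ((A - B) \<union> (B - A)) u"
proof -
  have A: "parity A u = parity (A - B) u * parity (A \<inter> B) u"
    unfolding parity_def using assms(1) by (subst prod.union_disjoint[symmetric]) (auto intro: prod.cong)
  have B: "parity B u = parity (B - A) u * parity (A \<inter> B) u"
    unfolding parity_def using assms(2) by (subst prod.union_disjoint[symmetric]) (auto intro: prod.cong)
  have "parity (A \<inter> B) u * parity (A \<inter> B) u = (\<Prod>i\<in>A \<inter> B. u i * u i)"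
    unfolding parity_def by (rule prod.distrib[symmetric])
  also have "\<dots> = (\<Prod>i\<in>A \<inter> B. 1)"
  proof (intro prod.cong refl)
    fix i assume "i \<in> A \<inter> B"
    then have "u i = -1 \<or> u i = 1" using assms(3) by blast
    then show "u i * u i = 1" by auto
  qed
  finally have sq: "parity (A \<inter> B) u * parity (A \<inter> B) u = 1" by simp
  have "parity ((A - B) \<union> (B - A)) u = parity (A - B) u * parity (B - A) u"
    unfolding parity_def using assms(1,2) by (subst prod.union_disjoint) auto
  then show ?thesis using sq unfolding A B by (metis mult.assoc mult.commute mult.right_neutral)
qed

text \<open>Flipping one coordinate of \<open>A\<close> is an involution of the cube that negates
  the parity.\<close>

lemma sum_parity_cube:
  assumes "A \<subseteq> {..<N}" "A \<noteq> {}"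
  shows "(\<Sum>u\<in>cube N. parity A u) = 0"
proof -
  obtain q where q: "q \<in> A" using assms(2) by blast
  have fin: "finite A" using assms(1) finite_subset by blast
  let ?flip = "\<lambda>u. u(q := - u q) :: nat \<Rightarrow> real"
  have "(\<Sum>u\<in>cube N. parity A u) = (\<Sum>u\<in>cube N. - parity A u)"
  proof (rule sum.reindex_bij_witness[of _ ?flip ?flip])
    fix u :: "nat \<Rightarrow> real" assume u: "u \<in> cube N"
    show "?flip u \<in> cube N" "?flip u \<in> cube N"
      using u q assms(1) by (auto simp: cube_def PiE_def Pi_def extensional_def)
    have "parity A (?flip u) = - u q * (\<Prod>i\<in>A - {q}. u i)"
      unfolding parity_def using fin q by (subst prod.remove[of A q]) auto
    also have "\<dots> = - parity A u"
      unfolding parity_def using fin q by (simp add: prod.remove[of A q])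
    finally show "- parity A (?flip u) = parity A u" by simp
  qed auto
  then show ?thesis by (simp add: sum_negf)
qed

section \<open>Functions of bounded degree and interpolation of sign patterns\<close>

text \<open>Multilinear polynomials of degree at most \<open>d\<close> in the variables
  \<open>Y\<close>, regarded as functions: only sign vectors on \<open>Y\<close> are tested, so
  squares of variables reduce to 1, and \<open>u\<close> is arbitrary off \<open>Y\<close>.\<close>

definition low_degree :: "nat set \<Rightarrow> nat \<Rightarrow> ((nat \<Rightarrow> real) \<Rightarrow> real) \<Rightarrow> bool" where
  "low_degree Y d q \<longleftrightarrow>
     (\<exists>w. \<forall>u. (\<forall>i\<in>Y. u i \<in> {-1, 1}) \<longrightarrow>
        q u = (\<Sum>R | R \<subseteq> Y \<and> card R \<le> d. w R * parity R u))"

lemma low_degree_cong: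
  assumes "low_degree Y d q" "\<And>u. \<forall>i\<in>Y. u i \<in> {-1, 1} \<Longrightarrow> q' u = q u"
  shows "low_degree Y d q'"
proof -
  obtain w where "\<forall>u. (\<forall>i\<in>Y. u i \<in> {-1, 1}) \<longrightarrow>
      q u = (\<Sum>R | R \<subseteq> Y \<and> card R \<le> d. w R * parity R u)"
    using assms(1) unfolding low_degree_def by blast
  with assms(2) show ?thesis unfolding low_degree_def by (intro exI[of _ w]) auto
qed

lemma low_degree_sum:
  assumes "\<And>a. a \<in> I \<Longrightarrow> low_degree Y d (q a)"
  shows "low_degree Y d (\<lambda>u. \<Sum>a\<in>I. q a u)"
proof -
  from assms have "\<forall>a\<in>I. \<exists>w. \<forall>u. (\<forall>i\<in>Y. u i \<in> {-1, 1}) \<longrightarrow>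
      q a u = (\<Sum>R | R \<subseteq> Y \<and> card R \<le> d. w R * parity R u)"
    unfolding low_degree_def by blast
  from bchoice[OF this] obtain w where w: "\<And>a u. a \<in> I \<Longrightarrow> \<forall>i\<in>Y. u i \<in> {-1, 1} \<Longrightarrow>
      q a u = (\<Sum>R | R \<subseteq> Y \<and> card R \<le> d. w a R * parity R u)"
    by blast
  show ?thesis
    unfolding low_degree_def
  proof (intro exI allI impI)
    fix u :: "nat \<Rightarrow> real" assume "\<forall>i\<in>Y. u i \<in> {-1, 1}"
    then have "(\<Sum>a\<in>I. q a u) = (\<Sum>a\<in>I. \<Sum>R | R \<subseteq> Y \<and> card R \<le> d. w a R * parity R u)"
      by (intro sum.cong refl w)
    then show "(\<Sum>a\<in>I. q a u) = (\<Sum>R | R \<subseteq> Y \<and> card R \<le> d. (\<Sum>a\<in>I. w a R) * parity R u)"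
      by (simp add: sum.swap[of _ _ I] sum_distrib_right)
  qed
qed

lemma low_degree_scale:
  assumes "low_degree Y d q"
  shows "low_degree Y d (\<lambda>u. c * q u)"
proof -
  obtain w where w: "\<And>u. \<forall>i\<in>Y. u i \<in> {-1, 1} \<Longrightarrow>
      q u = (\<Sum>R | R \<subseteq> Y \<and> card R \<le> d. w R * parity R u)"
    using assms unfolding low_degree_def by blast
  show ?thesis
    unfolding low_degree_def
    by (rule exI[of _ "\<lambda>R. c * w R"]) (simp add: w sum_distrib_left mult.assoc)
qed

lemma low_degree_diff:
  assumes "low_degree Y d p" "low_degree Y d q"
  shows "low_degree Y d (\<lambda>u. p u - q u)"
proof -
  have "low_degree Y d (\<lambda>u. \<Sum>b\<in>{True, False}. (if b then p else (\<lambda>u. -1 * q u)) u)"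
  proof (rule low_degree_sum)
    fix b show "low_degree Y d (if b then p else (\<lambda>u. -1 * q u))"
      using assms(1) low_degree_scale[OF assms(2), of "-1"] by (cases b) auto
  qed
  then show ?thesis by simp
qed

lemma low_degree_parity:
  assumes "finite Y" "R \<subseteq> Y" "card R \<le> d"
  shows "low_degree Y d (parity R)"
proof -
  have "finite {R. R \<subseteq> Y \<and> card R \<le> d}" using assms(1) by simp
  then have "parity R u = (\<Sum>R' | R' \<subseteq> Y \<and> card R' \<le> d. of_bool (R' = R) * parity R' u)" for u
    using assms(2,3) by (subst sum.mono_neutral_right[where S = "{R}"]) auto
  then show ?thesis
    unfolding low_degree_def by (intro exI[of _ "\<lambda>R'. of_bool (R' = R)"]) blast
qed

lemma low_degree_mono:
  assumes "low_degree Y d q" "d \<le> e" "finite Y"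
  shows "low_degree Y e q"
proof -
  obtain w where w: "\<And>u. \<forall>i\<in>Y. u i \<in> {-1, 1} \<Longrightarrow>
      q u = (\<Sum>R | R \<subseteq> Y \<and> card R \<le> d. w R * parity R u)"
    using assms(1) unfolding low_degree_def by blast
  have "low_degree Y e (\<lambda>u. \<Sum>R | R \<subseteq> Y \<and> card R \<le> d. w R * parity R u)"
    using assms(2,3) by (intro low_degree_sum low_degree_scale low_degree_parity) auto
  then show ?thesis by (rule low_degree_cong) (rule w)
qed

text \<open>Multiplying a parity by \<open>u i\<close> inserts \<open>i\<close> into its set or
  removes it, so the size grows by at most 1.\<close>

lemma low_degree_mult_var:
  assumes "low_degree Y d q" "i \<in> Y" "finite Y"
  shows "low_degree Y (Suc d) (\<lambda>u. u i * q u)"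
proof -
  obtain w where w: "\<And>u. \<forall>i\<in>Y. u i \<in> {-1, 1} \<Longrightarrow>
      q u = (\<Sum>R | R \<subseteq> Y \<and> card R \<le> d. w R * parity R u)"
    using assms(1) unfolding low_degree_def by blast
  let ?s = "\<lambda>R. (R - {i}) \<union> ({i} - R)"
  have card_s: "card (?s R) \<le> Suc d" if "R \<subseteq> Y" "card R \<le> d" for R
  proof -
    have "finite R" using that(1) assms(3) finite_subset by blast
    then have "card (?s R) \<le> card (insert i R)" by (intro card_mono) auto
    also have "\<dots> \<le> Suc (card R)" using \<open>finite R\<close> by (simp add: card_insert_if)
    finally show ?thesis using that(2) by simp
  qed
  have "low_degree Y (Suc d) (\<lambda>u. \<Sum>R | R \<subseteq> Y \<and> card R \<le> d. w R * parity (?s R) u)"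
    using assms(2,3) card_s by (intro low_degree_sum low_degree_scale low_degree_parity) auto
  then show ?thesis
  proof (rule low_degree_cong)
    fix u :: "nat \<Rightarrow> real" assume u: "\<forall>i\<in>Y. u i \<in> {-1, 1}"
    have "u i * parity R u = parity (?s R) u" if "R \<subseteq> Y" for R
    proof -
      have "parity R u * parity {i} u = parity (?s R) u"
        using that assms(2,3) u finite_subset by (intro parity_mult) blast+
      then show ?thesis by (simp add: parity_def mult.commute)
    qed
    then show "u i * q u = (\<Sum>R | R \<subseteq> Y \<and> card R \<le> d. w R * parity (?s R) u)"
      unfolding w[OF u] sum_distrib_left
      by (intro sum.cong) (auto simp: mult.left_commute)
  qed
qed

text \<open>The number of -1's is the sum of \<open>(1 - u i) / 2\<close>, so each factor has degree
  1 in the variables. The slope \<open>a\<close> is 1 when that number itself is the argument and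
  1/2 when the argument is half of it.\<close>

lemma low_degree_prod_affine:
  assumes "finite Y" "finite J"
  shows "low_degree Y (card J) (\<lambda>u. \<Prod>j\<in>J. a * real (card {i \<in> Y. u i = -1}) - c j)"
  using assms(2)
proof (induction J rule: finite_induct)
  case empty
  have "low_degree Y 0 (parity {})" using assms(1) by (intro low_degree_parity) auto
  then show ?case by (simp add: parity_def[abs_def])
next
  case (insert j J)
  let ?P = "\<lambda>u. \<Prod>j\<in>J. a * real (card {i \<in> Y. u i = -1}) - c j"
  \<comment> \<open>The product with the new factor is expanded into terms to which the closure
    rules apply.\<close>
  have "low_degree Y (Suc (card J))
     (\<lambda>u. (a / 2) * (\<Sum>i\<in>Y. ?P u - u i * ?P u) - c j * ?P u)"
    using insert.IH assms(1)
    by (intro low_degree_diff low_degree_scale low_degree_sum low_degree_mult_var)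
       (auto intro: low_degree_mono)
  moreover have "(\<Prod>j\<in>insert j J. a * real (card {i \<in> Y. u i = -1}) - c j) =
      (a / 2) * (\<Sum>i\<in>Y. ?P u - u i * ?P u) - c j * ?P u" if "\<forall>i\<in>Y. u i \<in> {-1, 1}" for u
  proof -
    have "(\<Sum>i\<in>Y. ?P u - u i * ?P u) = (\<Sum>i\<in>Y. 1 - u i) * ?P u"
      by (simp add: sum_distrib_right left_diff_distrib)
    moreover have "real (card {i \<in> Y. u i = -1}) = (\<Sum>i\<in>Y. 1 - u i) / 2"
      using card_minus_ones[OF assms(1) that] by (simp add: sum_divide_distrib)
    moreover have "(a * (s / 2) - c j) * P = (a / 2) * (s * P) - c j * P" for s P :: real
      by (simp add: left_diff_distrib)
    ultimately show ?thesis by (simp only: prod.insert[OF insert.hyps])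
  qed
  ultimately have "low_degree Y (Suc (card J))
      (\<lambda>u. \<Prod>j\<in>insert j J. a * real (card {i \<in> Y. u i = -1}) - c j)"
    by (rule low_degree_cong)
  then show ?case using insert.hyps by simp
qed

text \<open>One simple root is placed midway between \<open>j\<close> and \<open>j + 1\<close> for
  each sign change there; half-integral roots keep the product nonzero at integers. The sign
  \<open>e\<close> adjusts the value at 0.\<close>

lemma sign_change_interpolation:
  fixes D :: "nat \<Rightarrow> real"
  assumes "\<And>j. j \<le> k \<Longrightarrow> D j \<in> {-1, 1}"
  defines "J \<equiv> {j. j < k \<and> D j \<noteq> D (Suc j)}"
  shows "\<exists>e\<in>{-1, 1}. \<forall>m\<le>k. sgn (e * (\<Prod>j\<in>J. real m - real j - 1/2)) = D m"
proof -
  have finJ: "finite J" unfolding J_def by simp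
  let ?s = "\<lambda>m. \<Prod>j\<in>J. sgn (real m - real j - 1/2)"
  have sgns: "sgn (\<Prod>j\<in>J. real m - real j - 1/2) = ?s m" for m
    by (induction J rule: infinite_finite_induct) (auto simp: sgn_mult)
  have s0: "?s 0 \<in> {-1, 1}"
  proof -
    have "?s 0 = (\<Prod>j\<in>J. -1)" by (intro prod.cong) (auto simp: sgn_if)
    then show ?thesis by (simp add: minus_one_power_iff)
  qed
  have main: "m \<le> k \<Longrightarrow> D m = D 0 * ?s 0 * ?s m" for m
  proof (induction m)
    case 0
    then show ?case using s0 by auto
  next
    case (Suc m)
    \<comment> \<open>Between \<open>m\<close> and \<open>m + 1\<close> lies no other root than the
      one belonging to \<open>m\<close>.\<close>
    have "?s (Suc m) = (if m \<in> J then - ?s m else ?s m)"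
    proof (cases "m \<in> J")
      case True
      have "(\<Prod>j\<in>J - {m}. sgn (real (Suc m) - real j - 1/2)) = (\<Prod>j\<in>J - {m}. sgn (real m - real j - 1/2))"
        by (intro prod.cong refl) (auto simp: sgn_if)
      then show ?thesis using True finJ by (simp add: prod.remove[of J m] sgn_if)
    next
      case False
      have "?s (Suc m) = ?s m"
      proof (intro prod.cong refl)
        fix j assume "j \<in> J"
        then have "j \<noteq> m" using False by auto
        then show "sgn (real (Suc m) - real j - 1/2) = sgn (real m - real j - 1/2)"
          by (auto simp: sgn_if)
      qed
      then show ?thesis using False by simp
    qed
    moreover have "D (Suc m) = (if m \<in> J then - D m else D m)"
      using assms(1)[of m] assms(1)[of "Suc m"] Suc.prems unfolding J_def by auto
    ultimately show ?case using Suc by auto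
  qed
  have e: "D 0 * ?s 0 \<in> {-1, 1}" using s0 assms(1)[of 0] by auto
  moreover have "sgn (D 0 * ?s 0 * (\<Prod>j\<in>J. real m - real j - 1/2)) = D m" if "m \<le> k" for m
  proof -
    have "sgn (D 0 * ?s 0) = D 0 * ?s 0" using e by auto
    then show ?thesis using main[OF that] by (metis sgn_mult sgns)
  qed
  ultimately show ?thesis by blast
qed

section \<open>Symmetric functions\<close>

definition weight :: "nat \<Rightarrow> (nat \<Rightarrow> real) \<Rightarrow> nat" where
  "weight n x = card {j \<in> {..<n}. x j = -1}"

lemma weight_le: "weight n x \<le> n"
  unfolding weight_def using card_mono[of "{..<n}" "{j \<in> {..<n}. x j = -1}"] by auto

text \<open>Points of equal weight differ by a permutation: match the -1's of one with those of the
  other, and likewise the 1's.\<close>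

lemma symmetric_function_eqI:
  assumes "symmetric_function n f" "x \<in> cube n" "y \<in> cube n" "weight n x = weight n y"
  shows "f y = f x"
proof -
  let ?A = "{j \<in> {..<n}. x j = -1}" and ?B = "{j \<in> {..<n}. y j = -1}"
  obtain g where g: "bij_betw g ?B ?A"
    using assms(4) finite_same_card_bij[of ?B ?A] by (auto simp: weight_def)
  have "card ({..<n} - ?B) = card ({..<n} - ?A)"
    using assms(4) by (subst (1 2) card_Diff_subset) (auto simp: weight_def)
  then obtain h where h: "bij_betw h ({..<n} - ?B) ({..<n} - ?A)"
    using finite_same_card_bij[of "{..<n} - ?B" "{..<n} - ?A"] by auto
  define p where "p = (\<lambda>j. if j \<in> ?B then g j else if j < n then h j else j)"
  have "bij_betw p ?B ?A"
    using g by (rule bij_betw_cong[THEN iffD1, rotated]) (simp add: p_def)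
  moreover have "bij_betw p ({..<n} - ?B) ({..<n} - ?A)"
    using h by (rule bij_betw_cong[THEN iffD1, rotated]) (auto simp: p_def)
  ultimately have "bij_betw p (?B \<union> ({..<n} - ?B)) (?A \<union> ({..<n} - ?A))"
    by (rule bij_betw_combine) auto
  moreover have "?B \<union> ({..<n} - ?B) = {..<n}" "?A \<union> ({..<n} - ?A) = {..<n}" by auto
  ultimately have "bij_betw p {..<n} {..<n}" by simp
  then have perm: "p permutes {..<n}"
    by (rule bij_imp_permutes) (auto simp: p_def)
  have "x (p j) = y j" for j
  proof -
    consider "j \<in> ?B" | "j < n" "j \<notin> ?B" | "j \<ge> n" by fastforce
    then show ?thesis
    proof cases
      case 1
      then have "g j \<in> ?A" using g by (auto simp: bij_betw_def)
      then show ?thesis using 1 by (simp add: p_def)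
    next
      case 2
      then have "h j \<in> {..<n} - ?A" using h by (auto simp: bij_betw_def)
      then have "x (h j) = 1" using cube_signs[OF assms(2)] by auto
      moreover have "y j = 1" using 2 cube_signs[OF assms(3)] by auto
      ultimately show ?thesis using 2 by (simp add: p_def)
    next
      \<comment> \<open>Outside \<open>{..<n}\<close> both points are \<open>undefined\<close>, and
        \<open>p\<close> is the identity.\<close>
      case 3
      then have "x j = y j" using assms(2,3) by (auto simp: cube_def PiE_def extensional_def)
      then show ?thesis using 3 by (simp add: p_def)
    qed
  qed
  then have "x \<circ> p = y" by auto
  then show ?thesis using assms(1,2) perm by (auto simp: symmetric_function_def)
qed

text \<open>The description defining \<open>predicate_of\<close> has a unique solution at a weight
  that occurs: symmetry gives existence, and \<open>x\<close> itself gives uniqueness.\<close>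

lemma eq_predicate_of_weight:
  assumes "symmetric_function n f" "x \<in> cube n"
  shows "f x = predicate_of n f (weight n x)"
  unfolding predicate_of_def
proof (rule the_equality[symmetric])
  show "\<forall>y\<in>cube n. card {j \<in> {..<n}. y j = -1} = weight n x \<longrightarrow> f y = f x"
    using symmetric_function_eqI[OF assms] unfolding weight_def by metis
  then show "b = f x"
    if "\<forall>y\<in>cube n. card {j \<in> {..<n}. y j = -1} = weight n x \<longrightarrow> f y = b" for b
    using that assms(2) by (simp add: weight_def)
qed

lemma predicate_of_sign:
  assumes "boolean_function n f" "symmetric_function n f" "i \<le> n"
  shows "predicate_of n f i \<in> {-1, 1}"
proof -
  define x :: "nat \<Rightarrow> real" where "x = (\<lambda>j. if j < i then -1 else if j < n then 1 else undefined)"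
  have x: "x \<in> cube n" using assms(3) by (auto simp: x_def cube_def PiE_def extensional_def)
  have "{j \<in> {..<n}. x j = -1} = {..<i}" using assms(3) by (auto simp: x_def)
  then have "weight n x = i" by (simp add: weight_def)
  then have "predicate_of n f i = f x" using eq_predicate_of_weight[OF assms(2) x] by simp
  then show ?thesis using assms(1) x by (auto simp: boolean_function_def)
qed

section \<open>Lower bound on a window of weights\<close>

text \<open>The first \<open>4k\<close> variables are grouped into the \<open>2k\<close> pairs \<open>{2q, 2q + 1}\<close>: a pair with
  \<open>q \<in> Y\<close> is set to \<open>(u q, u q)\<close>, changing the weight by 0 or 2, any other pair to
  \<open>(u q, - u q)\<close>, whose weight is always 1.\<close>

definition paired_point ::
  "nat \<Rightarrow> nat \<Rightarrow> nat \<Rightarrow> nat set \<Rightarrow> (nat \<Rightarrow> real) \<Rightarrow> nat \<Rightarrow> real" where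
  "paired_point n k r Y u v =
     (if v < 4 * k then if v div 2 \<in> Y \<or> even v then u (v div 2) else - u (v div 2)
      else if v < 4 * k + r then -1 else if v < n then 1 else undefined)"

lemma paired_point_cube:
  assumes "r + 4 * k \<le> n" "u \<in> cube (2 * k)"
  shows "paired_point n k r Y u \<in> cube n"
proof -
  have "u (v div 2) = 1 \<or> u (v div 2) = -1" if "v < 4 * k" for v
    using cube_signs[OF assms(2)] that by auto
  then show ?thesis
    using assms(1) by (auto simp: cube_def PiE_def Pi_def extensional_def paired_point_def)
qed

lemma sum_lessThan_pairs:
  fixes g :: "nat \<Rightarrow> 'a::comm_monoid_add"
  shows "(\<Sum>v<2 * m. g v) = (\<Sum>q<m. g (2 * q) + g (2 * q + 1))"
  by (induction m) (simp_all add: add.assoc)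

lemma prod_lessThan_pairs:
  fixes g :: "nat \<Rightarrow> 'a::comm_monoid_mult"
  shows "(\<Prod>v<2 * m. g v) = (\<Prod>q<m. g (2 * q) * g (2 * q + 1))"
  by (induction m) (simp_all add: mult.assoc)

text \<open>Each of the \<open>r\<close> fixed coordinates and each of the \<open>k\<close> pairs
  outside \<open>Y\<close> adds 1; a pair in \<open>Y\<close> adds 2 exactly when its bit is
  -1.\<close>

lemma weight_paired_point:
  assumes rk: "r + 4 * k \<le> n" and u: "u \<in> cube (2 * k)"
    and Y: "Y \<subseteq> {..<2 * k}" "card Y = k"
  shows "weight n (paired_point n k r Y u) = r + k + 2 * card {q \<in> Y. u q = -1}"
proof -
  let ?x = "paired_point n k r Y u"
  have finY: "finite Y" using Y(1) finite_subset by blast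
  have uY: "\<forall>q\<in>Y. u q \<in> {-1, 1}" using cube_signs[OF u] Y(1) by auto
  have "real (weight n ?x) = (\<Sum>v<n. (1 - ?x v) / 2)"
    unfolding weight_def
    by (rule card_minus_ones[OF _ cube_signs[OF paired_point_cube[OF rk u]]]) simp
  also have "{..<n} = {..<4 * k} \<union> {4 * k..<4 * k + r} \<union> {4 * k + r..<n}" using rk by auto
  also have "(\<Sum>v\<in>\<dots>. (1 - ?x v) / 2) =
      (\<Sum>v<4 * k. (1 - ?x v) / 2) + (\<Sum>v\<in>{4 * k..<4 * k + r}. (1 - ?x v) / 2)
      + (\<Sum>v\<in>{4 * k + r..<n}. (1 - ?x v) / 2)"
    by (subst sum.union_disjoint; (subst sum.union_disjoint)?) auto
  also have "(\<Sum>v\<in>{4 * k + r..<n}. (1 - ?x v) / 2) = 0"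
    by (rule sum.neutral) (auto simp: paired_point_def)
  also have "(\<Sum>v\<in>{4 * k..<4 * k + r}. (1 - ?x v) / 2) = (\<Sum>v\<in>{4 * k..<4 * k + r}. 1)"
    by (rule sum.cong) (auto simp: paired_point_def)
  also have "(\<Sum>v<4 * k. (1 - ?x v) / 2) = (\<Sum>q<2 * k. (1 - ?x (2 * q)) / 2 + (1 - ?x (2 * q + 1)) / 2)"
    using sum_lessThan_pairs[of _ "2 * k"] by simp
  \<comment> \<open>A pair \<open>(u, -u)\<close> yields
    \<open>(1 - u) / 2 + (1 + u) / 2 = 1\<close>, a pair \<open>(u, u)\<close> yields
    \<open>1 - u\<close>.\<close>
  also have "\<dots> = (\<Sum>q<2 * k. (if q \<in> Y then 0 else 1) + (if q \<in> Y then 1 - u q else 0))"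
    by (rule sum.cong) (auto simp: paired_point_def field_simps)
  also have "\<dots> = real (card ({..<2 * k} - Y)) + 2 * (\<Sum>q\<in>Y. (1 - u q) / 2)"
    using Y(1) by (simp add: sum.distrib sum.If_cases Diff_eq Int_absorb1 flip: sum_divide_distrib)
  also have "real (card ({..<2 * k} - Y)) = k"
    using Y finY by (simp add: card_Diff_subset)
  also have "(\<Sum>q\<in>Y. (1 - u q) / 2) = real (card {q \<in> Y. u q = -1})"
    by (rule card_minus_ones[symmetric]) (fact finY uY)+
  finally have "real (weight n ?x) = real (r + k + 2 * card {q \<in> Y. u q = -1})" by simp
  then show ?thesis by linarith
qed

text \<open>The bits that remain in the parity of \<open>S\<close> at a paired point: when both
  members of a pair lie in \<open>S\<close>, its bit is squared away.\<close>

definition split_pairs :: "nat \<Rightarrow> nat set \<Rightarrow> nat set" where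
  "split_pairs k S = {q. q < 2 * k \<and> (2 * q \<in> S) \<noteq> (2 * q + 1 \<in> S)}"

text \<open>Each coordinate below \<open>4 * k\<close> is its bit times the value it takes when all
  bits are 1. The latter values form a factor independent of \<open>u\<close>.\<close>

lemma parity_paired_point:
  assumes "finite S" "u \<in> cube (2 * k)"
  shows "parity S (paired_point n k r Y u) =
    parity S (paired_point n k r Y (\<lambda>_. 1)) * parity (split_pairs k S) u"
proof -
  let ?x = "paired_point n k r Y"
  have "?x u v = ?x (\<lambda>_. 1) v * (if v < 4 * k then u (v div 2) else 1)" for v
    by (simp add: paired_point_def)
  then have "parity S (?x u) = (\<Prod>v\<in>S. ?x (\<lambda>_. 1) v * (if v < 4 * k then u (v div 2) else 1))"
    unfolding parity_def by (intro prod.cong refl)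
  also have "\<dots> = parity S (?x (\<lambda>_. 1)) * (\<Prod>v\<in>S. if v < 4 * k then u (v div 2) else 1)"
    by (simp add: prod.distrib parity_def)
  also have "(\<Prod>v\<in>S. if v < 4 * k then u (v div 2) else 1) = (\<Prod>v<4 * k. if v \<in> S then u (v div 2) else 1)"
    using assms(1) by (simp add: prod.If_cases Int_def conj_commute)
  also have "\<dots> = (\<Prod>q<2 * k. (if 2 * q \<in> S then u q else 1) * (if 2 * q + 1 \<in> S then u q else 1))"
    using prod_lessThan_pairs[of "\<lambda>v. if v \<in> S then u (v div 2) else 1" "2 * k"]
    by (simp cong: if_cong)
  also have "\<dots> = (\<Prod>q<2 * k. if q \<in> split_pairs k S then u q else 1)"
  proof (rule prod.cong[OF refl])
    fix q assume "q \<in> {..<2 * k}"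
    moreover from this have "u q = -1 \<or> u q = 1" using cube_signs[OF assms(2)] by auto
    ultimately show "(if 2 * q \<in> S then u q else 1) * (if 2 * q + 1 \<in> S then u q else 1) =
        (if q \<in> split_pairs k S then u q else 1)"
      by (auto simp: split_pairs_def)
  qed
  also have "\<dots> = parity (split_pairs k S) u"
    unfolding parity_def by (simp add: prod.If_cases split_pairs_def Int_def)
  finally show ?thesis .
qed

section \<open>Averaging over the choices of pairs\<close>

text \<open>The choice \<open>\<sigma>\<close> of one pair from each couple \<open>{2g, 2g + 1}\<close> with \<open>g < k\<close>.\<close>

definition selection :: "nat \<Rightarrow> nat set \<Rightarrow> nat set" where
  "selection k \<sigma> = {q. q < 2 * k \<and> (q div 2 \<in> \<sigma> \<longleftrightarrow> even q)}"

lemma card_selection: "card (selection k \<sigma>) = k"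
proof -
  have "card (selection k \<sigma>) = (\<Sum>q<2 * k. of_bool (q div 2 \<in> \<sigma> \<longleftrightarrow> even q))"
    by (simp add: selection_def Int_def)
  also have "\<dots> = (\<Sum>q<k. 1)"
    unfolding sum_lessThan_pairs by (rule sum.cong) auto
  finally show ?thesis by simp
qed

text \<open>If any selection contains \<open>T\<close>, then \<open>T\<close> has at most one pair
  from each couple and prescribes the choice in \<open>card T\<close> couples, leaving the others
  free. The product form covers \<open>d > k\<close> as well.\<close>

lemma card_selections_containing:
  assumes "d \<le> card T"
  shows "card {\<sigma> \<in> Pow {..<k}. T \<subseteq> selection k \<sigma>} * 2 ^ d \<le> 2 ^ k"
proof (cases "\<exists>\<sigma>. T \<subseteq> selection k \<sigma>")
  case False
  then show ?thesis by simp
next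
  case True
  then obtain \<sigma>0 where T: "T \<subseteq> selection k \<sigma>0" by blast
  let ?F = "{\<sigma> \<in> Pow {..<k}. T \<subseteq> selection k \<sigma>}" and ?G = "(\<lambda>q. q div 2) ` T"
  have "inj_on (\<lambda>q. q div 2) T"
  proof (rule inj_onI)
    fix p q assume pq: "p \<in> T" "q \<in> T" and eq: "p div 2 = q div 2"
    have "p div 2 \<in> \<sigma>0 \<longleftrightarrow> even p" "q div 2 \<in> \<sigma>0 \<longleftrightarrow> even q"
      using T pq by (auto simp: selection_def)
    then have "even p \<longleftrightarrow> even q" using eq by simp
    with eq show "p = q" by presburger
  qed
  then have cG: "card ?G = card T" by (rule card_image)
  have G: "?G \<subseteq> {..<k}" using T by (auto simp: selection_def)
  \<comment> \<open>All members of \<open>?F\<close> agree on the couples met by \<open>T\<close>,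
    so the rest determines them.\<close>
  have "inj_on (\<lambda>\<sigma>. \<sigma> - ?G) ?F"
  proof (rule inj_onI)
    fix \<sigma> \<tau> assume st: "\<sigma> \<in> ?F" "\<tau> \<in> ?F" "\<sigma> - ?G = \<tau> - ?G"
    have "g \<in> \<sigma> \<longleftrightarrow> g \<in> \<tau>" if "g \<in> ?G" for g using st that by (auto simp: selection_def)
    then show "\<sigma> = \<tau>" using st(3) by blast
  qed
  then have "card ?F \<le> card (Pow ({..<k} - ?G))"
    by (rule card_inj_on_le) auto
  also have "\<dots> = 2 ^ (k - card T)"
    using G cG by (simp add: card_Pow card_Diff_subset finite_subset[OF G])
  finally have "card ?F * 2 ^ d \<le> 2 ^ (k - card T) * 2 ^ card T"
    using assms by (intro mult_mono power_increasing) auto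
  also have "\<dots> = 2 ^ k"
    using card_mono[OF _ G] cG by (simp flip: power_add)
  finally show ?thesis .
qed

text \<open>Union bound: a set with at least \<open>d\<close> split pairs spoils at most a
  \<open>2 ^ -d\<close> fraction of the selections, so fewer than \<open>2 ^ d\<close> sets cannot
  spoil all of them.\<close>

lemma exists_selection:
  assumes "length C < 2 ^ d"
  shows "\<exists>\<sigma>. \<forall>(w, S)\<in>set C. split_pairs k S \<subseteq> selection k \<sigma> \<longrightarrow> card (split_pairs k S) < d"
proof (rule ccontr)
  assume neg: "\<not> ?thesis"
  define \<S> where "\<S> = {S \<in> snd ` set C. d \<le> card (split_pairs k S)}"
  let ?bad = "\<lambda>S. {\<sigma> \<in> Pow {..<k}. split_pairs k S \<subseteq> selection k \<sigma>}"
  have fin: "finite \<S>" by (simp add: \<S>_def)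
  have "Pow {..<k} \<subseteq> (\<Union>S\<in>\<S>. ?bad S)"
    using neg unfolding \<S>_def by (force simp: not_less)
  then have "card (Pow {..<k}) \<le> card (\<Union>S\<in>\<S>. ?bad S)"
    using fin by (intro card_mono) auto
  also have "\<dots> \<le> (\<Sum>S\<in>\<S>. card (?bad S))"
    by (rule card_UN_le[OF fin])
  finally have "2 ^ k * 2 ^ d \<le> (\<Sum>S\<in>\<S>. card (?bad S) * 2 ^ d)"
    by (simp add: card_Pow flip: sum_distrib_right)
  also have "\<dots> \<le> (\<Sum>S\<in>\<S>. 2 ^ k)"
    by (intro sum_mono card_selections_containing) (simp add: \<S>_def)
  also have "\<dots> = card \<S> * 2 ^ k" by simp
  also have "card \<S> \<le> length C"
  proof -
    have "card \<S> \<le> card (snd ` set C)" unfolding \<S>_def by (intro card_mono) auto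
    also have "\<dots> \<le> length C" by (meson card_image_le card_length le_trans List.finite_set)
    finally show ?thesis .
  qed
  finally have "2 ^ d \<le> length C" by (simp add: mult.commute)
  then show False using assms by simp
qed

text \<open>A duality argument: for a smaller circuit, \<open>\<psi>\<close> would have the sign of
  the weighted sum \<open>p\<close> at every point and yet be orthogonal to every gate occurring in
  \<open>p\<close>.\<close>

lemma window_bound:
  assumes bf: "boolean_function n f" and sf: "symmetric_function n f"
    and C: "circuit_computes n C f" and rk: "r + 4 * k \<le> n"
  shows "2 ^ card {j. j < k \<and> predicate_of n f (r + k + 2 * j) \<noteq> predicate_of n f (r + k + 2 * j + 2)}
           \<le> length C"
proof (rule ccontr)
  define D where "D j = predicate_of n f (r + k + 2 * j)" for j
  define d where "d = card {j. j < k \<and> D j \<noteq> D (Suc j)}"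
  assume "\<not> ?thesis"
  then have "length C < 2 ^ d" by (simp add: d_def D_def add.assoc)
  then obtain \<sigma> where \<sigma>: "\<And>w S. (w, S) \<in> set C \<Longrightarrow> split_pairs k S \<subseteq> selection k \<sigma> \<Longrightarrow>
      card (split_pairs k S) < d"
    using exists_selection[of C d k] by blast
  define Y where "Y = selection k \<sigma>"
  have Y: "Y \<subseteq> {..<2 * k}" "card Y = k" "finite Y"
    using card_selection[of k \<sigma>] by (auto simp: Y_def selection_def)
  have D: "D j \<in> {-1, 1}" if "j \<le> k" for j
    unfolding D_def by (rule predicate_of_sign[OF bf sf]) (use that rk in linarith)
  \<comment> \<open>Twisting by the full parity exchanges sign changes and non-changes, so that \<open>h\<close> below has
    degree \<open>k - d\<close>.\<close>
  define D' where "D' j = (-1) ^ j * D j" for j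
  define J where "J = {j. j < k \<and> D' j \<noteq> D' (Suc j)}"
  have D': "D' j \<in> {-1, 1}" if "j \<le> k" for j
    using D[OF that] by (auto simp: D'_def minus_one_power_iff)
  have "J = {..<k} - {j. j < k \<and> D j \<noteq> D (Suc j)}"
  proof -
    have "D' j \<noteq> D' (Suc j) \<longleftrightarrow> D j = D (Suc j)" if "j < k" for j
      using D[of j] D[of "Suc j"] that by (auto simp: D'_def minus_one_power_iff)
    then show ?thesis unfolding J_def by blast
  qed
  then have cardJ: "card J = k - d"
    unfolding d_def by (simp only:) (subst card_Diff_subset, auto)
  have d_le: "d \<le> k"
    unfolding d_def using card_mono[of "{..<k}" "{j. j < k \<and> D j \<noteq> D (Suc j)}"] by auto
  obtain e where e: "e \<in> {-1, 1::real}"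
    "\<And>m. m \<le> k \<Longrightarrow> sgn (e * (\<Prod>j\<in>J. real m - real j - 1/2)) = D' m"
    using sign_change_interpolation[of k D', folded J_def] D' by blast
  define m where "m u = card {q \<in> Y. u q = -1}" for u :: "nat \<Rightarrow> real"
  define h where "h u = (\<Prod>j\<in>J. real (m u) - real j - 1/2)" for u
  \<comment> \<open>On sign vectors \<open>parity Y u\<close> is \<open>(-1) ^ m u\<close>, which
    turns the pattern \<open>D'\<close> interpolated by \<open>h\<close> back into
    \<open>D\<close>.\<close>
  define \<psi> where "\<psi> u = e * (parity Y u * h u)" for u
  define p where "p u = (\<Sum>(w, S)\<leftarrow>C. w * parity S (paired_point n k r Y u))" for u
  have pos: "\<psi> u * p u > 0" if u: "u \<in> cube (2 * k)" for u
  proof -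
    have uY: "\<forall>q\<in>Y. u q \<in> {-1, 1}" using cube_signs[OF u] Y(1) by auto
    have mk: "m u \<le> k"
      unfolding m_def using Y(2) card_mono[OF Y(3), of "{q \<in> Y. u q = -1}"] by simp
    let ?x = "paired_point n k r Y u"
    have x: "?x \<in> cube n" by (rule paired_point_cube[OF rk u])
    have "sgn (p u) = f ?x"
      using C x by (simp add: circuit_computes_def circuit_output_def p_def)
    also have "\<dots> = D (m u)"
      using eq_predicate_of_weight[OF sf x] weight_paired_point[OF rk u Y(1,2)]
      by (simp add: D_def m_def)
    finally have sp: "sgn (p u) = D (m u)" .
    have "sgn (\<psi> u) = (-1) ^ m u * sgn (e * h u)"
      unfolding \<psi>_def parity_eq_power[OF Y(3) uY] m_def[symmetric]
      by (simp add: sgn_mult minus_one_power_iff)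
    also have "\<dots> = D (m u)"
      unfolding h_def e(2)[OF mk] by (simp add: D'_def minus_one_power_iff)
    finally have "sgn (\<psi> u * p u) = 1"
      using sp D[OF mk] by (auto simp: sgn_mult)
    then show ?thesis by (simp add: sgn_1_pos)
  qed
  obtain c where c: "\<And>u. \<forall>i\<in>Y. u i \<in> {-1, 1} \<Longrightarrow>
      h u = (\<Sum>R | R \<subseteq> Y \<and> card R \<le> k - d. c R * parity R u)"
  proof -
    have "low_degree Y (k - d) (\<lambda>u. \<Prod>j\<in>J. 1 * real (card {i \<in> Y. u i = -1}) - (real j + 1/2))"
      using low_degree_prod_affine[OF Y(3), of J 1] cardJ by (simp add: J_def)
    moreover have "(\<lambda>u. \<Prod>j\<in>J. 1 * real (card {i \<in> Y. u i = -1}) - (real j + 1/2)) = h"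
      unfolding h_def m_def by (simp add: diff_diff_eq)
    ultimately show thesis using that unfolding low_degree_def by auto
  qed
  have orth: "(\<Sum>u\<in>cube (2 * k). \<psi> u * parity S (paired_point n k r Y u)) = 0"
    if S: "(w, S) \<in> set C" for w S
  proof -
    define T where "T = split_pairs k S"
    have T: "T \<subseteq> {..<2 * k}" "finite T" by (auto simp: T_def split_pairs_def)
    have "finite S" using C S finite_subset by (fastforce simp: circuit_computes_def)
    note pS = parity_paired_point[OF this, of _ k n r Y, folded T_def]
    let ?s = "\<lambda>R. let Z = (Y - R) \<union> (R - Y) in (Z - T) \<union> (T - Z)"
    \<comment> \<open>\<open>?s R\<close> is the symmetric difference of \<open>Y\<close>,
      \<open>R\<close> and \<open>T\<close>. It is empty only if \<open>T = Y - R\<close>; such a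
      \<open>T\<close> lies in \<open>Y\<close> and has at least \<open>k - (k - d) = d\<close>
      elements, which the choice of \<open>\<sigma>\<close> excludes.\<close>
    have nonempty: "?s R \<noteq> {}" if "R \<subseteq> Y" "card R \<le> k - d" for R
    proof
      assume "?s R = {}"
      then have "T = Y - R" using that(1) by (auto simp: Let_def)
      moreover from this have "card T \<ge> d"
        using that Y d_le by (simp add: card_Diff_subset finite_subset)
      ultimately show False using \<sigma>[OF S] by (auto simp: Y_def T_def)
    qed
    have "(\<Sum>u\<in>cube (2 * k). \<psi> u * parity S (paired_point n k r Y u)) =
      (\<Sum>u\<in>cube (2 * k). \<Sum>R | R \<subseteq> Y \<and> card R \<le> k - d.
         e * parity S (paired_point n k r Y (\<lambda>_. 1)) * c R * parity (?s R) u)"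
    proof (rule sum.cong[OF refl])
      fix u assume u: "u \<in> cube (2 * k)"
      have uY: "\<forall>q\<in>Y. u q \<in> {-1, 1}" using cube_signs[OF u] Y(1) by auto
      have "parity (?s R) u = parity Y u * parity R u * parity T u" if "R \<subseteq> Y" for R
      proof -
        have "finite R" using that Y(3) finite_subset by blast
        then have "parity Y u * parity R u = parity ((Y - R) \<union> (R - Y)) u"
          using uY that Y(3) by (intro parity_mult) auto
        moreover have "parity ((Y - R) \<union> (R - Y)) u * parity T u = parity (?s R) u"
          unfolding Let_def
          using \<open>finite R\<close> Y(1,3) T that cube_signs[OF u] by (intro parity_mult) blast+
        ultimately show ?thesis by simp
      qed
      then show "\<psi> u * parity S (paired_point n k r Y u) =
        (\<Sum>R | R \<subseteq> Y \<and> card R \<le> k - d.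
           e * parity S (paired_point n k r Y (\<lambda>_. 1)) * c R * parity (?s R) u)"
        unfolding \<psi>_def pS[OF u] c[OF uY] sum_distrib_left sum_distrib_right
        by (intro sum.cong refl) (simp add: mult.assoc mult.left_commute mult.commute)
    qed
    also have "\<dots> = (\<Sum>R | R \<subseteq> Y \<and> card R \<le> k - d.
         e * parity S (paired_point n k r Y (\<lambda>_. 1)) * c R * (\<Sum>u\<in>cube (2 * k). parity (?s R) u))"
      by (subst sum.swap) (simp add: sum_distrib_left)
    also have "\<dots> = 0"
    proof (rule sum.neutral, rule ballI)
      fix R assume R: "R \<in> {R. R \<subseteq> Y \<and> card R \<le> k - d}"
      then have "?s R \<subseteq> {..<2 * k}" using Y(1) T(1) by (auto simp: Let_def)
      then have "(\<Sum>u\<in>cube (2 * k). parity (?s R) u) = 0"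
        using nonempty R by (intro sum_parity_cube) auto
      then show "e * parity S (paired_point n k r Y (\<lambda>_. 1)) * c R * (\<Sum>u\<in>cube (2 * k). parity (?s R) u) = 0"
        by simp
    qed
    finally show ?thesis .
  qed
  \<comment> \<open>Generalised to lists of gates of \<open>C\<close>, so that orthogonality stays
    available for the head in the induction.\<close>
  have "(\<Sum>u\<in>cube (2 * k). \<psi> u * (\<Sum>(w, S)\<leftarrow>C'. w * parity S (paired_point n k r Y u))) = 0"
    if "set C' \<subseteq> set C" for C'
    using that
  proof (induction C')
    case (Cons a C')
    obtain w S where a: "a = (w, S)" by (cases a)
    have "(\<Sum>u\<in>cube (2 * k). \<psi> u * (\<Sum>(w, S)\<leftarrow>a # C'. w * parity S (paired_point n k r Y u))) =
      w * (\<Sum>u\<in>cube (2 * k). \<psi> u * parity S (paired_point n k r Y u)) +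
      (\<Sum>u\<in>cube (2 * k). \<psi> u * (\<Sum>(w, S)\<leftarrow>C'. w * parity S (paired_point n k r Y u)))"
      by (simp add: a distrib_left sum.distrib sum_distrib_left mult.left_commute)
    then show ?case using Cons orth[of w S] a by simp
  qed simp
  then have "(\<Sum>u\<in>cube (2 * k). \<psi> u * p u) = 0" by (simp add: p_def)
  moreover have "(\<Sum>u\<in>cube (2 * k). \<psi> u * p u) > 0"
  proof (rule sum_pos)
    have "(\<lambda>v. if v < 2 * k then 1 else undefined) \<in> cube (2 * k)" by (auto simp: cube_def PiE_def extensional_def)
    then show "cube (2 * k) \<noteq> {}" by blast
  qed (auto intro: finite_cube pos)
  ultimately show False by simp
qed

section \<open>From windows to the odd-even degree\<close>

text \<open>Halve the scale until it first drops to \<open>i\<close> or below. The previous scale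
  exceeded \<open>i\<close>, so the new one is at least \<open>i / 2\<close>, and three times it
  exceeds \<open>i\<close> because \<open>i > 0\<close>.\<close>

lemma dyadic_cover:
  fixes n i t :: nat
  assumes "9 \<le> n" "0 < i" "2 * i + 2 \<le> n" "n \<le> 2 ^ t"
  shows "\<exists>\<tau><t. (n - 1) div 2 ^ (\<tau> + 2) \<le> i \<and> i < 3 * ((n - 1) div 2 ^ (\<tau> + 2))"
proof -
  define K where "K \<tau> = (n - 1) div 2 ^ (\<tau> + 2)" for \<tau> :: nat
  have Suc: "K (Suc \<tau>) = K \<tau> div 2" for \<tau>
    by (simp add: K_def mult.commute flip: div_mult2_eq)
  have lt: "\<tau> < t" if "K \<tau> > 0" for \<tau>
  proof -
    have "2 ^ (\<tau> + 2) \<le> n - 1" using that by (auto simp: K_def div_greater_zero_iff)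
    also have "\<dots> < 2 ^ t" using assms(1,4) by linarith
    finally show ?thesis by (simp add: power_strict_increasing_iff del: power_Suc)
  qed
  \<comment> \<open>In fact \<open>K t = 0\<close>, since a positive value would give
    \<open>t < t\<close>.\<close>
  have "K t \<le> i" using lt[of t] by (cases "K t > 0") auto
  define \<tau> where "\<tau> = (LEAST \<tau>. K \<tau> \<le> i)"
  have le: "K \<tau> \<le> i" unfolding \<tau>_def by (rule LeastI) (fact \<open>K t \<le> i\<close>)
  have "i < 3 * K \<tau>"
  proof (cases \<tau>)
    \<comment> \<open>There is no previous scale here: \<open>n \<ge> 9\<close> gives
      \<open>K 0 \<ge> 2\<close>, while \<open>i \<le> 2 * K 0 + 1\<close>.\<close>
    case 0
    have "K 0 = (n - 1) div 4" by (simp add: K_def)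
    moreover have "n - 1 < 4 * ((n - 1) div 4) + 4" "2 \<le> (n - 1) div 4" using assms(1) by auto
    ultimately show ?thesis unfolding 0 using assms(3) by linarith
  next
    case (Suc \<tau>')
    then have "\<not> K \<tau>' \<le> i" unfolding \<tau>_def using not_less_Least[of \<tau>'] by (metis lessI)
    then show ?thesis using assms(2) unfolding Suc \<open>\<And>\<tau>. K (Suc \<tau>) = K \<tau> div 2\<close> by presburger
  qed
  with le lt[of \<tau>] show ?thesis unfolding K_def by (intro exI[of _ \<tau>]) linarith
qed

text \<open>At each of \<open>t\<close> scales four windows are used, for two residues mod 2 and two
  halves of the range, each with at most \<open>B\<close> changes. The summand 2 accounts for the
  positions 0 and \<open>n - 2\<close>, which are counted separately.\<close>

lemma deg_oe_le_of_circuit: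
  assumes bf: "boolean_function n f" and sf: "symmetric_function n f"
    and C: "circuit_computes n C f" "circuit_size C < 2 ^ B"
    and n: "9 \<le> n" "n \<le> 2 ^ t"
  shows "deg_oe n f \<le> 2 + 4 * t * B"
proof -
  define K where "K \<tau> = (n - 1) div 2 ^ (\<tau> + 2)" for \<tau> :: nat
  \<comment> \<open>The spare 1 allows the window to be shifted by one without truncating a
    subtraction.\<close>
  have K: "4 * K \<tau> + 1 \<le> n" for \<tau>
  proof -
    have "K \<tau> = (n - 1) div 4 div 2 ^ \<tau>" by (simp add: K_def mult.commute flip: div_mult2_eq)
    then have "K \<tau> \<le> (n - 1) div 4" by simp
    then show ?thesis using n(1) by presburger
  qed
  \<comment> \<open>Offsets 0 and 1 serve the lower half; the other two give the reflected windows
    for the upper half.\<close>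
  define R where "R \<tau> = {0, 1, n - 4 * K \<tau>, n - 4 * K \<tau> - 1}" for \<tau>
  define W where "W r k = (\<lambda>j. r + k + 2 * j) `
      {j. j < k \<and> predicate_of n f (r + k + 2 * j) \<noteq> predicate_of n f (r + k + 2 * j + 2)}" for r k
  have W: "card (W r (K \<tau>)) \<le> B" if "r \<in> R \<tau>" for r \<tau>
  proof -
    let ?J = "{j. j < K \<tau> \<and> predicate_of n f (r + K \<tau> + 2 * j) \<noteq> predicate_of n f (r + K \<tau> + 2 * j + 2)}"
    have "r + 4 * K \<tau> \<le> n" using that K[of \<tau>] by (auto simp: R_def)
    from window_bound[OF bf sf C(1) this] C(2)[unfolded circuit_size_def]
    have "2 ^ card ?J < (2::nat) ^ B" by (rule le_less_trans)
    then have "card ?J < B" by (rule power_less_imp_less_exp[rotated]) simp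
    moreover have "card (W r (K \<tau>)) \<le> card ?J" unfolding W_def by (rule card_image_le) simp
    ultimately show ?thesis by simp
  qed
  let ?U = "\<Union>\<tau><t. \<Union>r\<in>R \<tau>. W r (K \<tau>)"
  have "{i. i + 2 \<le> n \<and> predicate_of n f i \<noteq> predicate_of n f (i + 2)} \<subseteq> {0, n - 2} \<union> ?U"
  proof
    fix i assume "i \<in> {i. i + 2 \<le> n \<and> predicate_of n f i \<noteq> predicate_of n f (i + 2)}"
    then have i: "i + 2 \<le> n" "predicate_of n f i \<noteq> predicate_of n f (i + 2)" by auto
    have WI: "i \<in> ?U" if "\<tau> < t" "r \<in> R \<tau>" "j < K \<tau>" "i = r + K \<tau> + 2 * j" for \<tau> r j
      using that i(2) unfolding W_def by blast
    show "i \<in> {0, n - 2} \<union> ?U"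
    proof (cases "i = 0 \<or> i = n - 2")
      case False
      show ?thesis
      proof (cases "2 * i + 2 \<le> n")
        case True
        then obtain \<tau> where \<tau>: "\<tau> < t" "K \<tau> \<le> i" "i < 3 * K \<tau>"
          using dyadic_cover[of n i t] n False unfolding K_def by auto
        \<comment> \<open>The offset \<open>r\<close> makes \<open>i - K \<tau> - r\<close> even, as
          weights in a window advance by 2.\<close>
        define r j where "r = (i - K \<tau>) mod 2" and "j = (i - K \<tau>) div 2"
        have "i \<in> ?U"
        proof (rule WI[of \<tau> r j])
          show "r \<in> R \<tau>" by (auto simp: R_def r_def)
          show "j < K \<tau>" using \<tau> by (auto simp: j_def)
          show "i = r + K \<tau> + 2 * j" using \<tau>(2) by (simp add: r_def j_def)
        qed fact
        then show ?thesis by blast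
      next
        case False2: False
        \<comment> \<open>The reflection of weights \<open>w\<close> to \<open>n - w\<close> takes
          the step from \<open>i\<close> to \<open>i + 2\<close> to the one starting at
          \<open>n - 2 - i\<close>.\<close>
        have "2 * (n - 2 - i) + 2 \<le> n" "0 < n - 2 - i" using False False2 i(1) by linarith+
        then obtain \<tau> where \<tau>: "\<tau> < t" "K \<tau> \<le> n - 2 - i" "n - 2 - i < 3 * K \<tau>"
          using dyadic_cover[of n "n - 2 - i" t] n unfolding K_def by auto
        \<comment> \<open>With offset \<open>n - 4 * K \<tau> - s\<close> the index must satisfy
          \<open>2 * j = a + s - 2\<close>, so \<open>s\<close> is chosen to make
          \<open>a + s\<close> even.\<close>
        define a where "a = 3 * K \<tau> - (n - 2 - i)"
        have a: "a > 0" "a \<le> 2 * K \<tau>" "a + n = 3 * K \<tau> + i + 2" using \<tau> i(1) by (auto simp: a_def)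
        define s j where "s = a mod 2" and "j = (a - 1) div 2"
        have sj: "2 * j + 2 = a + s" using a(1) unfolding s_def j_def by presburger
        have "i \<in> ?U"
        proof (rule WI[of \<tau> "n - 4 * K \<tau> - s" j])
          have "s = 0 \<or> s = 1" unfolding s_def by linarith
          then show "n - 4 * K \<tau> - s \<in> R \<tau>" by (auto simp: R_def)
          show "j < K \<tau>" using sj a \<open>s = 0 \<or> s = 1\<close> by linarith
          show "i = n - 4 * K \<tau> - s + K \<tau> + 2 * j"
            using sj a K[of \<tau>] \<open>s = 0 \<or> s = 1\<close> by linarith
        qed fact
        then show ?thesis by blast
      qed
    qed auto
  qed
  then have "deg_oe n f \<le> card ({0, n - 2} \<union> ?U)"
    unfolding deg_oe_def by (intro card_mono) (auto simp: R_def W_def)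
  also have "\<dots> \<le> card {0, n - 2} + card ?U" by (rule card_Un_le)
  also have "card {0, n - 2} \<le> 2" by (simp add: card_insert_if)
  also have "card ?U \<le> (\<Sum>\<tau><t. card (\<Union>r\<in>R \<tau>. W r (K \<tau>)))" by (rule card_UN_le) simp
  also have "\<dots> \<le> (\<Sum>\<tau><t. 4 * B)"
  proof (rule sum_mono)
    fix \<tau>
    have "card (\<Union>r\<in>R \<tau>. W r (K \<tau>)) \<le> (\<Sum>r\<in>R \<tau>. card (W r (K \<tau>)))"
      by (rule card_UN_le) (simp add: R_def)
    also have "\<dots> \<le> card (R \<tau>) * B" using W by (rule sum_bounded_above[where K = B, simplified])
    also have "card (R \<tau>) \<le> 4" by (simp add: R_def card_insert_if)
    finally show "card (\<Union>r\<in>R \<tau>. W r (K \<tau>)) \<le> 4 * B" by simp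
  qed
  finally show ?thesis by simp
qed

section \<open>Small circuits for functions of small odd-even degree\<close>

text \<open>A set of at most \<open>d\<close> elements is coded by a word of length \<open>d\<close>
  over \<open>n + 1\<close> letters, the letter \<open>n\<close> serving as padding.\<close>

lemma card_small_subsets_le: "card {T. T \<subseteq> {..<n} \<and> card T \<le> d} \<le> (n + 1) ^ d"
proof -
  let ?L = "{xs. set xs \<subseteq> {..n} \<and> length xs = d}"
  have "{T. T \<subseteq> {..<n} \<and> card T \<le> d} \<subseteq> (\<lambda>xs. set xs - {n}) ` ?L"
  proof
    fix T assume "T \<in> {T. T \<subseteq> {..<n} \<and> card T \<le> d}"
    then have T: "T \<subseteq> {..<n}" "card T \<le> d" "finite T" by (auto intro: finite_subset)
    let ?xs = "sorted_list_of_set T @ replicate (d - card T) n"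
    have "?xs \<in> ?L" using T by auto
    moreover have "T = set ?xs - {n}" using T by auto
    ultimately show "T \<in> (\<lambda>xs. set xs - {n}) ` ?L" by blast
  qed
  then have "card {T. T \<subseteq> {..<n} \<and> card T \<le> d} \<le> card ?L"
    by (rule surj_card_le[rotated]) (simp add: finite_lists_length_eq)
  then show ?thesis by (simp add: card_lists_length_eq)
qed

text \<open>The weights in the class are \<open>2 * m + b\<close>, and the sign changes of the
  predicate along them are among those counted by \<open>deg_oe\<close>; interpolate in
  \<open>m\<close>.\<close>

lemma low_degree_sign_on_parity_class:
  assumes bf: "boolean_function n f" and sf: "symmetric_function n f" and b: "b < 2"
  shows "\<exists>q. low_degree {..<n} (deg_oe n f) q \<and>
           (\<forall>x\<in>cube n. weight n x mod 2 = b \<longrightarrow> sgn (q x) = f x)"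
proof (cases "b \<le> n")
  case False
  \<comment> \<open>The class of odd weights is empty for \<open>n = 0\<close>, so any function will
    do.\<close>
  then have "n = 0" "b = 1" using b by auto
  then have "weight n x mod 2 \<noteq> b" for x using weight_le[of n x] by auto
  moreover have "low_degree {..<n} (deg_oe n f) (parity {})" by (rule low_degree_parity) auto
  ultimately show ?thesis by blast
next
  case True
  define k where "k = (n - b) div 2"
  define D where "D j = predicate_of n f (2 * j + b)" for j
  define J where "J = {j. j < k \<and> D j \<noteq> D (Suc j)}"
  have le: "2 * j + b \<le> n \<longleftrightarrow> j \<le> k" for j using True unfolding k_def by presburger
  obtain e where e: "\<And>m. m \<le> k \<Longrightarrow> sgn (e * (\<Prod>j\<in>J. real m - real j - 1/2)) = D m"
    using sign_change_interpolation[of k D, folded J_def] predicate_of_sign[OF bf sf] le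
    unfolding D_def by blast
  \<comment> \<open>Interpolation in \<open>m = (weight - b) / 2\<close>, hence the slope 1/2 and
    the shift \<open>b / 2\<close>.\<close>
  let ?q = "\<lambda>x. e * (\<Prod>j\<in>J. 1/2 * real (card {i \<in> {..<n}. x i = -1}) - (real b / 2 + real j + 1/2))"
  have "card J = card ((\<lambda>j. 2 * j + b) ` J)" by (intro card_image[symmetric] inj_onI) simp
  also have "\<dots> \<le> deg_oe n f"
    unfolding deg_oe_def
  proof (rule card_mono)
    show "finite {i. i + 2 \<le> n \<and> predicate_of n f i \<noteq> predicate_of n f (i + 2)}"
      by (rule finite_subset[of _ "{..n}"]) auto
    show "(\<lambda>j. 2 * j + b) ` J \<subseteq> {i. i + 2 \<le> n \<and> predicate_of n f i \<noteq> predicate_of n f (i + 2)}"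
    proof
      fix i assume "i \<in> (\<lambda>j. 2 * j + b) ` J"
      then obtain j where j: "j < k" "D j \<noteq> D (Suc j)" "i = 2 * j + b" by (auto simp: J_def)
      then have "i + 2 = 2 * Suc j + b" by simp
      then show "i \<in> {i. i + 2 \<le> n \<and> predicate_of n f i \<noteq> predicate_of n f (i + 2)}"
        using j le[of "Suc j"] unfolding D_def by auto
    qed
  qed
  finally have "card J \<le> deg_oe n f" .
  then have "low_degree {..<n} (deg_oe n f) ?q"
    by (intro low_degree_scale low_degree_mono[OF low_degree_prod_affine]) (auto simp: J_def)
  moreover have "sgn (?q x) = f x" if x: "x \<in> cube n" and par: "weight n x mod 2 = b" for x
  proof -
    define m where "m = weight n x div 2"
    have wm: "weight n x = 2 * m + b" using par unfolding m_def by presburger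
    have "1/2 * real (card {i \<in> {..<n}. x i = -1}) - (real b / 2 + real j + 1/2) = real m - real j - 1/2" for j
      using wm unfolding weight_def by (simp add: add_divide_distrib)
    then have "?q x = e * (\<Prod>j\<in>J. real m - real j - 1/2)" by presburger
    moreover have "m \<le> k" using le[of m] weight_le[of n x] wm by simp
    ultimately have "sgn (?q x) = D m" using e by presburger
    then show ?thesis using eq_predicate_of_weight[OF sf x] wm by (simp add: D_def)
  qed
  ultimately show ?thesis by blast
qed

text \<open>The full parity \<open>\<chi>\<close> is 1 on even and -1 on odd weights, so
  \<open>(1 + \<chi>) / 2\<close> and \<open>(1 - \<chi>) / 2\<close> select the right one of two
  low-degree functions.\<close>

lemma exists_circuit:
  assumes bf: "boolean_function n f" and sf: "symmetric_function n f"
  shows "\<exists>C. circuit_computes n C f \<and> circuit_size C \<le> 2 * (n + 1) ^ deg_oe n f"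
proof -
  define F where "F = {R. R \<subseteq> {..<n} \<and> card R \<le> deg_oe n f}"
  obtain q w where q: "\<And>b x. b < 2 \<Longrightarrow> x \<in> cube n \<Longrightarrow> weight n x mod 2 = b \<Longrightarrow> sgn (q b x) = f x"
    and w: "\<And>b x. b < (2::nat) \<Longrightarrow> \<forall>i\<in>{..<n}. x i \<in> {-1, 1} \<Longrightarrow> q b x = (\<Sum>R\<in>F. w b R * parity R x)"
  proof -
    have "\<exists>w. \<forall>x\<in>cube n. weight n x mod 2 = b \<longrightarrow> sgn (\<Sum>R\<in>F. w R * parity R x) = f x"
      if b: "b < 2" for b
    proof -
      obtain q w where "\<forall>x\<in>cube n. weight n x mod 2 = b \<longrightarrow> sgn (q x) = f x"
        and "\<And>x. \<forall>i\<in>{..<n}. x i \<in> {-1, 1} \<Longrightarrow> q x = (\<Sum>R\<in>F. w R * parity R x)"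
        using low_degree_sign_on_parity_class[OF bf sf b] unfolding low_degree_def F_def by blast
      then show ?thesis using cube_signs by (intro exI[of _ w]) auto
    qed
    then obtain w where "\<And>b x. b < 2 \<Longrightarrow> x \<in> cube n \<Longrightarrow> weight n x mod 2 = b \<Longrightarrow>
        sgn (\<Sum>R\<in>F. w b R * parity R x) = f x"
      by metis
    then show thesis using that[of "\<lambda>b x. \<Sum>R\<in>F. w b R * parity R x" w] by blast
  qed
  have finF: "finite F" by (simp add: F_def)
  then obtain Rs where Rs: "set Rs = F" "distinct Rs" using finite_distinct_list by blast
  \<comment> \<open>Coefficients of the parities of \<open>R\<close> and of \<open>\<chi>\<close>
    times them after expansion; \<open>\<chi>\<close> complements the set. A set may occur in both
    lists, as a circuit may repeat gates.\<close>
  define C where "C = map (\<lambda>R. ((w 0 R + w 1 R) / 2, R)) Rs @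
    map (\<lambda>R. ((w 0 R - w 1 R) / 2, {..<n} - R)) Rs"
  have out: "circuit_output C x = f x" if x: "x \<in> cube n" for x
  proof -
    have sx: "\<forall>i\<in>{..<n}. x i \<in> {-1, 1}" by (rule cube_signs[OF x])
    define \<chi> where "\<chi> = parity {..<n} x"
    have \<chi>: "\<chi> = (-1) ^ weight n x"
      unfolding \<chi>_def weight_def by (rule parity_eq_power[OF finite_lessThan sx])
    have compl: "parity ({..<n} - R) x = \<chi> * parity R x" if "R \<in> F" for R
    proof -
      have R: "R \<subseteq> {..<n}" using that by (simp add: F_def)
      have "\<chi> * parity R x = parity (({..<n} - R) \<union> (R - {..<n})) x"
        unfolding \<chi>_def using sx R by (intro parity_mult) (auto intro: finite_subset)
      also have "({..<n} - R) \<union> (R - {..<n}) = {..<n} - R" using R by blast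
      finally show ?thesis by simp
    qed
    have "(\<Sum>(w, S)\<leftarrow>C. w * parity S x) =
      (\<Sum>R\<in>F. (w 0 R + w 1 R) / 2 * parity R x) + (\<Sum>R\<in>F. (w 0 R - w 1 R) / 2 * parity ({..<n} - R) x)"
      using Rs by (simp add: C_def comp_def sum_list_distinct_conv_sum_set)
    also have "(\<Sum>R\<in>F. (w 0 R - w 1 R) / 2 * parity ({..<n} - R) x) =
        (\<Sum>R\<in>F. (w 0 R - w 1 R) / 2 * (\<chi> * parity R x))"
      by (rule sum.cong) (simp_all add: compl)
    also have "(\<Sum>R\<in>F. (w 0 R + w 1 R) / 2 * parity R x) + \<dots> =
        (1 + \<chi>) / 2 * (\<Sum>R\<in>F. w 0 R * parity R x) + (1 - \<chi>) / 2 * (\<Sum>R\<in>F. w 1 R * parity R x)"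
      unfolding sum_distrib_left sum.distrib[symmetric]
      by (rule sum.cong) (simp_all add: field_simps)
    also have "\<dots> = (1 + \<chi>) / 2 * q 0 x + (1 - \<chi>) / 2 * q 1 x"
      using w sx by simp
    also have "\<dots> = q (weight n x mod 2) x"
      by (cases "even (weight n x)") (auto simp: \<chi> odd_iff_mod_2_eq_one even_iff_mod_2_eq_zero)
    finally show ?thesis
      unfolding circuit_output_def using q[of "weight n x mod 2" x] x by simp
  qed
  have "circuit_computes n C f"
    unfolding circuit_computes_def using out Rs(1) by (auto simp: C_def F_def)
  moreover have "circuit_size C = 2 * card F"
    using distinct_card[OF Rs(2)] Rs(1) by (simp add: C_def circuit_size_def)
  moreover have "card F \<le> (n + 1) ^ deg_oe n f"
    unfolding F_def by (rule card_small_subsets_le)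
  ultimately show ?thesis by fastforce
qed

section \<open>Circuits and polynomials\<close>

text \<open>On signs exponents matter only mod 2. Monomials that reduce to the same parity stay
  separate gates, so the size is exactly the number of monomials.\<close>

lemma circuit_of_polynomial:
  assumes "sign_represents n p f"
  shows "\<exists>C. circuit_computes n C f \<and> circuit_size C = num_monomials p"
proof -
  obtain ms where ms: "set ms = Poly_Mapping.keys p" "distinct ms"
    using finite_distinct_list[of "Poly_Mapping.keys p"] by auto
  define odds where "odds m = {i \<in> Poly_Mapping.keys m. odd (Poly_Mapping.lookup m i)}" for m :: "nat \<Rightarrow>\<^sub>0 nat"
  define C where "C = map (\<lambda>m. (Poly_Mapping.lookup p m, odds m)) ms"
  have vars: "Poly_Mapping.keys m \<subseteq> {..<n}" if "m \<in> Poly_Mapping.keys p" for m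
    using assms that by (auto simp: sign_represents_def mpoly_in_vars_def)
  have mono: "(\<Prod>i\<in>Poly_Mapping.keys m. x i ^ Poly_Mapping.lookup m i) = parity (odds m) x"
    if "x \<in> cube n" "m \<in> Poly_Mapping.keys p" for x m
  proof -
    have "x i ^ Poly_Mapping.lookup m i = (if odd (Poly_Mapping.lookup m i) then x i else 1)"
      if "i \<in> Poly_Mapping.keys m" for i
    proof -
      have "x i = -1 \<or> x i = 1"
        using cube_signs[OF \<open>x \<in> cube n\<close>] vars[OF \<open>m \<in> Poly_Mapping.keys p\<close>] that by auto
      then show ?thesis by auto
    qed
    then have "(\<Prod>i\<in>Poly_Mapping.keys m. x i ^ Poly_Mapping.lookup m i) =
        (\<Prod>i\<in>Poly_Mapping.keys m. if odd (Poly_Mapping.lookup m i) then x i else 1)"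
      by (intro prod.cong) auto
    then show ?thesis by (simp add: prod.If_cases parity_def odds_def Int_def)
  qed
  have "(\<Sum>(w, S)\<leftarrow>C. w * parity S x) = mpoly_eval p x" if "x \<in> cube n" for x
    using ms mono[OF that]
    by (simp add: C_def comp_def sum_list_distinct_conv_sum_set mpoly_eval_def)
  then have "circuit_computes n C f"
    using assms ms(1) vars
    by (auto simp: circuit_computes_def circuit_output_def sign_represents_def C_def odds_def)
  moreover have "circuit_size C = num_monomials p"
    using distinct_card[OF ms(2)] ms(1) by (simp add: circuit_size_def C_def num_monomials_def)
  ultimately show ?thesis by blast
qed

section \<open>From circuits to polynomials, and the minimum \<open>mon_pm\<close>\<close>

text \<open>Allows several polynomials to be summed over one common set of monomials, since
  coefficients outside the keys are 0.\<close>

lemma mpoly_eval_superset: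
  assumes "finite A" "Poly_Mapping.keys p \<subseteq> A"
  shows "mpoly_eval p x = (\<Sum>m\<in>A. Poly_Mapping.lookup p m *
           (\<Prod>i\<in>Poly_Mapping.keys m. x i ^ Poly_Mapping.lookup m i))"
  unfolding mpoly_eval_def using assms
  by (intro sum.mono_neutral_left) (auto simp: in_keys_iff)

lemma mpoly_eval_add: "mpoly_eval (p + q) x = mpoly_eval p x + mpoly_eval q x"
proof -
  let ?A = "Poly_Mapping.keys p \<union> Poly_Mapping.keys q"
  have "Poly_Mapping.keys (p + q) \<subseteq> ?A" by (rule Poly_Mapping.keys_add)
  then show ?thesis
    by (simp add: mpoly_eval_superset[of ?A] lookup_add distrib_right sum.distrib)
qed

text \<open>Each gate becomes a multilinear monomial; the size is only an upper bound because gates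
  on the same set merge and may cancel.\<close>

lemma exists_parity_polynomial:
  assumes "\<forall>(w, S)\<in>set C. S \<subseteq> {..<n}"
  shows "\<exists>p. mpoly_in_vars n p \<and> num_monomials p \<le> length C \<and>
           (\<forall>x. mpoly_eval p x = (\<Sum>(w, S)\<leftarrow>C. w * parity S x))"
  using assms
proof (induction C)
  case Nil
  show ?case by (rule exI[of _ 0]) (simp add: mpoly_in_vars_def num_monomials_def mpoly_eval_def)
next
  case (Cons a C)
  obtain w S where a: "a = (w, S)" by (cases a)
  have S: "S \<subseteq> {..<n}" "finite S" using Cons.prems a by (auto intro: finite_subset)
  obtain p where p: "mpoly_in_vars n p" "num_monomials p \<le> length C"
    "\<And>x. mpoly_eval p x = (\<Sum>(w, S)\<leftarrow>C. w * parity S x)"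
    using Cons by auto
  define m where "m = Abs_poly_mapping (\<lambda>i. if i \<in> S then 1 else 0 :: nat)"
  have lm: "Poly_Mapping.lookup m i = (if i \<in> S then 1 else 0)" for i
    unfolding m_def using S(2) by (subst lookup_Abs_poly_mapping) auto
  have km: "Poly_Mapping.keys m = S" by (auto simp: in_keys_iff lm split: if_splits)
  let ?p = "Poly_Mapping.single m w + p"
  have keys: "Poly_Mapping.keys ?p \<subseteq> insert m (Poly_Mapping.keys p)"
    using Poly_Mapping.keys_add[of "Poly_Mapping.single m w" p] by (auto split: if_splits)
  have "mpoly_eval (Poly_Mapping.single m w) x = w * parity S x" for x
    by (subst mpoly_eval_superset[of "{m}"]) (auto simp: km lm parity_def)
  then have "mpoly_eval ?p x = (\<Sum>(w, S)\<leftarrow>a # C. w * parity S x)" for x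
    by (simp add: mpoly_eval_add p(3) a)
  moreover have "mpoly_in_vars n ?p"
    using p(1) keys km S(1) by (auto simp: mpoly_in_vars_def)
  moreover have "num_monomials ?p \<le> length (a # C)"
  proof -
    have "num_monomials ?p \<le> card (insert m (Poly_Mapping.keys p))"
      unfolding num_monomials_def using keys by (intro card_mono) auto
    also have "\<dots> \<le> Suc (num_monomials p)" by (simp add: num_monomials_def card_insert_if)
    finally show ?thesis using p(2) by simp
  qed
  ultimately show ?case by blast
qed

lemma mon_pm_le_circuit_size:
  assumes "circuit_computes n C f"
  shows "mon_pm n f \<le> circuit_size C"
proof -
  obtain p where p: "mpoly_in_vars n p" "num_monomials p \<le> length C"
    "\<And>x. mpoly_eval p x = (\<Sum>(w, S)\<leftarrow>C. w * parity S x)"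
    using exists_parity_polynomial[of C n] assms by (auto simp: circuit_computes_def)
  then have "sign_represents n p f"
    using assms by (simp add: sign_represents_def circuit_computes_def circuit_output_def)
  then have "mon_pm n f \<le> num_monomials p"
    unfolding mon_pm_def by (intro Least_le) blast
  then show ?thesis using p(2) by (simp add: circuit_size_def)
qed

text \<open>The given circuit ensures that the \<open>LEAST\<close> in \<open>mon_pm\<close> ranges
  over a nonempty set, so the minimum is attained by a polynomial, which converts back without
  change of size.\<close>

lemma exists_circuit_size_mon_pm:
  assumes "circuit_computes n C f"
  shows "\<exists>C'. circuit_computes n C' f \<and> circuit_size C' = mon_pm n f"
proof -
  obtain p where "mpoly_in_vars n p" "\<And>x. mpoly_eval p x = (\<Sum>(w, S)\<leftarrow>C. w * parity S x)"
    using exists_parity_polynomial[of C n] assms by (auto simp: circuit_computes_def)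
  then have "sign_represents n p f"
    using assms by (simp add: sign_represents_def circuit_computes_def circuit_output_def)
  then have "\<exists>p. sign_represents n p f \<and> num_monomials p = mon_pm n f"
    unfolding mon_pm_def by (intro LeastI_ex[where P = "\<lambda>k. \<exists>p. sign_represents n p f \<and> num_monomials p = k"]) blast
  then show ?thesis using circuit_of_polynomial by metis
qed

section \<open>Asymptotics\<close>

text \<open>With \<open>L = log 2 n\<close>, the scales number about \<open>L\<close> and the size
  exponent is about \<open>L powr a\<close>; one more factor \<open>L\<close> absorbs the
  constants.\<close>

lemma polylog_deg_oe:
  fixes f :: "nat \<Rightarrow> (nat \<Rightarrow> real) \<Rightarrow> real"
  assumes bf: "\<And>n. boolean_function n (f n)" and sf: "\<And>n. symmetric_function n (f n)"
    and C: "\<And>n. circuit_computes n (C n) (f n)" "quasipoly_bounded (\<lambda>n. circuit_size (C n))"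
  shows "polylog_bounded (\<lambda>n. deg_oe n (f n))"
proof -
  obtain c where c: "\<forall>\<^sub>F n in sequentially. real (circuit_size (C n)) \<le> 2 powr (log 2 (real n) powr c)"
    using C(2) by (auto simp: quasipoly_bounded_def)
  define a where "a = max c 0"
  have "\<forall>\<^sub>F n in sequentially. real (deg_oe n (f n)) \<le> log 2 (real n) powr (a + 2)"
    \<comment> \<open>The bound below is at most \<open>(2 + 16) * (L * L powr a)\<close>, and
      \<open>18 \<le> L\<close> replaces the constant by \<open>L\<close>.\<close>
    using c eventually_ge_at_top[of "2 ^ 18"]
  proof eventually_elim
    case (elim n)
    define L where "L = log 2 (real n)"
    have "2 powr 18 \<le> real n" using elim(2) by simp
    then have L: "18 \<le> L" unfolding L_def using elim(2) by (subst le_log_iff) auto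
    define t where "t = nat \<lceil>L\<rceil>"
    \<comment> \<open>The added 1 makes \<open>B\<close> exceed \<open>L powr a\<close>, as a strict
      bound on the size is required.\<close>
    define B where "B = nat \<lfloor>L powr a\<rfloor> + 1"
    have "2 powr L = real n" unfolding L_def using elim(2) by (intro powr_log_cancel) auto
    then have "real n \<le> 2 powr real t"
      using powr_mono[of L "real t" 2] L unfolding t_def by simp
    then have "real n \<le> real (2 ^ t)" by (simp add: powr_realpow)
    then have n_le: "n \<le> 2 ^ t" by (simp only: of_nat_le_iff)
    have "real (circuit_size (C n)) \<le> 2 powr (L powr c)" using elim(1) by (simp add: L_def)
    also have "\<dots> \<le> 2 powr (L powr a)" using L by (intro powr_mono) (auto simp: a_def)
    also have "\<dots> < 2 powr real B" by (intro powr_less_mono) (auto simp: B_def, linarith)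
    finally have "real (circuit_size (C n)) < real (2 ^ B)" by (simp add: powr_realpow)
    then have "circuit_size (C n) < 2 ^ B" by (simp only: of_nat_less_iff)
    from deg_oe_le_of_circuit[OF bf sf C(1) this _ n_le]
    have "deg_oe n (f n) \<le> 2 + 4 * t * B" using elim(2) by simp
    then have "real (deg_oe n (f n)) \<le> real (2 + 4 * t * B)" by (simp only: of_nat_le_iff)
    also have "\<dots> = 2 + 4 * real t * real B" by simp
    also have "\<dots> \<le> 2 + 4 * (2 * L) * (2 * L powr a)"
    proof -
      have "1 \<le> L powr a" using L by (intro ge_one_powr_ge_zero) (auto simp: a_def)
      then have "real B \<le> 2 * L powr a" unfolding B_def by simp linarith
      moreover have "real t \<le> 2 * L" using L unfolding t_def by linarith
      ultimately show ?thesis using L by (intro add_left_mono mult_mono) auto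
    qed
    also have "\<dots> \<le> 18 * (L * L powr a)"
    proof -
      have "1 * 1 \<le> L * L powr a"
        using L by (intro mult_mono ge_one_powr_ge_zero) (auto simp: a_def)
      then show ?thesis by simp
    qed
    also have "\<dots> \<le> L * (L * L powr a)" using L by (intro mult_right_mono) auto
    also have "\<dots> = L powr (a + 2)" using L by (simp add: powr_add power2_eq_square)
    finally show ?case by (simp add: L_def)
  qed
  then show ?thesis unfolding polylog_bounded_def by blast
qed

text \<open>For degree \<open>d\<close> the size \<open>2 * (n + 1) ^ d\<close> is at most
  \<open>2 powr (1 + (1 + L) * d)\<close>, again with \<open>L = log 2 n\<close>.\<close>

lemma quasipoly_circuit:
  fixes f :: "nat \<Rightarrow> (nat \<Rightarrow> real) \<Rightarrow> real"
  assumes bf: "\<And>n. boolean_function n (f n)" and sf: "\<And>n. symmetric_function n (f n)"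
    and "polylog_bounded (\<lambda>n. deg_oe n (f n))"
  shows "\<exists>C. (\<forall>n. circuit_computes n (C n) (f n)) \<and> quasipoly_bounded (\<lambda>n. circuit_size (C n))"
proof -
  obtain c where c: "\<forall>\<^sub>F n in sequentially. real (deg_oe n (f n)) \<le> log 2 (real n) powr c"
    using assms(3) by (auto simp: polylog_bounded_def)
  define a where "a = max c 0"
  obtain C where C: "\<And>n. circuit_computes n (C n) (f n)"
      "\<And>n. circuit_size (C n) \<le> 2 * (n + 1) ^ deg_oe n (f n)"
    using exists_circuit[OF bf sf] by metis
  have "\<forall>\<^sub>F n in sequentially. real (circuit_size (C n)) \<le> 2 powr (log 2 (real n) powr (a + 2))"
    \<comment> \<open>\<open>3 \<le> L\<close> absorbs the constant in
      \<open>1 + 2 * L * L powr a \<le> 3 * (L * L powr a)\<close>.\<close>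
    using c eventually_ge_at_top[of "2 ^ 3"]
  proof eventually_elim
    case (elim n)
    define L where "L = log 2 (real n)"
    define d where "d = deg_oe n (f n)"
    have "2 powr 3 \<le> real n" using elim(2) by simp
    then have L: "3 \<le> L" unfolding L_def using elim(2) by (subst le_log_iff) auto
    have nL: "2 powr L = real n" unfolding L_def using elim(2) by (intro powr_log_cancel) auto
    have "real (n + 1) \<le> 2 * real n" using elim(2) by simp
    also have "\<dots> = 2 powr (1 + L)" by (simp add: powr_add nL)
    finally have n1: "real (n + 1) \<le> 2 powr (1 + L)" .
    have d: "real d \<le> L powr a"
    proof -
      have "L powr c \<le> L powr a" using L by (intro powr_mono) (auto simp: a_def)
      then show ?thesis using elim(1) by (simp add: d_def L_def)
    qed
    have "real (circuit_size (C n)) \<le> real (2 * (n + 1) ^ d)"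
      using C(2)[of n] unfolding d_def by (simp only: of_nat_le_iff)
    also have "\<dots> = 2 * real (n + 1) ^ d" by simp
    also have "\<dots> \<le> 2 * (2 powr (1 + L)) ^ d" using n1 by (intro mult_left_mono power_mono) auto
    also have "(2 powr (1 + L)) ^ d = 2 powr ((1 + L) * real d)"
      by (simp add: powr_powr flip: powr_realpow)
    also have "2 * 2 powr ((1 + L) * real d) = 2 powr (1 + (1 + L) * real d)"
      using powr_add[of 2 1 "(1 + L) * real d"] by simp
    also have "\<dots> \<le> 2 powr (L powr (a + 2))"
    proof (rule powr_mono)
      have ge1: "1 \<le> L * L powr a"
        using L mult_mono[of 1 L 1 "L powr a"] ge_one_powr_ge_zero[of L a] by (auto simp: a_def)
      have "1 + (1 + L) * real d \<le> 1 + (2 * L) * L powr a"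
        using L d by (intro add_left_mono mult_mono) auto
      also have "\<dots> \<le> 3 * (L * L powr a)" using ge1 by simp
      also have "\<dots> \<le> L * (L * L powr a)" using L by (intro mult_right_mono) auto
      also have "\<dots> = L powr (a + 2)" using L by (simp add: powr_add power2_eq_square)
      finally show "1 + (1 + L) * real d \<le> L powr (a + 2)" .
    qed simp
    finally show ?case by (simp add: L_def)
  qed
  then show ?thesis using C(1) unfolding quasipoly_bounded_def by blast
qed

theorem mainTheorem3:
  fixes f :: "nat \<Rightarrow> (nat \<Rightarrow> real) \<Rightarrow> real"
  assumes "\<And>n. boolean_function n (f n)"
    and "\<And>n. symmetric_function n (f n)"
  shows "((\<exists>C. (\<forall>n. circuit_computes n (C n) (f n)) \<and> quasipoly_bounded (\<lambda>n. circuit_size (C n)))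
            \<longleftrightarrow> polylog_bounded (\<lambda>n. deg_oe n (f n)))
       \<and> (quasipoly_bounded (\<lambda>n. mon_pm n (f n)) \<longleftrightarrow> polylog_bounded (\<lambda>n. deg_oe n (f n)))"
proof -
  let ?circ = "\<exists>C. (\<forall>n. circuit_computes n (C n) (f n)) \<and> quasipoly_bounded (\<lambda>n. circuit_size (C n))"
  have 1: "?circ \<longleftrightarrow> polylog_bounded (\<lambda>n. deg_oe n (f n))"
    using polylog_deg_oe[of f] quasipoly_circuit[of f] assms by blast
  have 2: "quasipoly_bounded (\<lambda>n. mon_pm n (f n)) \<longleftrightarrow> ?circ"
  proof
    assume "quasipoly_bounded (\<lambda>n. mon_pm n (f n))"
    \<comment> \<open>Every symmetric function has some circuit, so the minimum is attained for each
      \<open>n\<close>.\<close>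
    moreover have "\<forall>n. \<exists>C. circuit_computes n C (f n) \<and> circuit_size C = mon_pm n (f n)"
      using exists_circuit[OF assms] exists_circuit_size_mon_pm by blast
    then obtain C where "\<forall>n. circuit_computes n (C n) (f n) \<and> circuit_size (C n) = mon_pm n (f n)"
      by metis
    ultimately show ?circ by (intro exI[of _ C]) simp
  next
    assume ?circ
    then obtain C c where C: "\<And>n. circuit_computes n (C n) (f n)"
      and c: "\<forall>\<^sub>F n in sequentially. real (circuit_size (C n)) \<le> 2 powr (log 2 (real n) powr c)"
      by (auto simp: quasipoly_bounded_def)
    from c have "\<forall>\<^sub>F n in sequentially. real (mon_pm n (f n)) \<le> 2 powr (log 2 (real n) powr c)"
    proof eventually_elim
      case (elim n)
      then show ?case using mon_pm_le_circuit_size[OF C[of n]] by linarith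
    qed
    then show "quasipoly_bounded (\<lambda>n. mon_pm n (f n))" unfolding quasipoly_bounded_def by blast
  qed
  from 1 2 show ?thesis by blast
qed

end
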